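(* Let $p_0=1+\frac{\log_6 2}{1+\log_6 2}$ and let $0<p<p_0$. For every ergodic dynamical system $\mathbf{X}=(X,\Sigma,\mu,T)$ with $(X,\Sigma,\mu)$ nonatomic, there are three functions $F,G,H\in L^p(\mathbf{X})$ such that $$\limsup_{N\to\infty}\frac{1}{N}\sum_{n=1}^{N}F(T^nx)\,G(T^{2n}x)\,H(T^{3n}x)=\infty$$ for $\mu$-almost every $x\in X$.
   Context: A dynamical system $\mathbf{X}=(X,\Sigma,\mu,T)$ is a complete probability space $(X,\Sigma,\mu)$ together with an invertible, bimeasurable transformation $T:X\to X$ that preserves $\mu$, i.e. $\mu T^{-1}=\mu$. $L^p(\mathbf{X})$ denotes $L^p(X,\Sigma,\mu)$ (real-valued functions). $\log_6$ is the logarithm in base $6$. *)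

theory Defs
  imports "HOL-Probability.Probability"
begin

locale dynamical_system = prob_space M + complete_measure M
  for M :: "'a measure" +
  fixes T :: "'a \<Rightarrow> 'a"
  assumes bij: "bij_betw T (space M) (space M)"
    and T_measurable: "T \<in> measurable M M"
    and inv_measurable: "the_inv_into (space M) T \<in> measurable M M"
    and preserving: "distr M M T = M"

locale ergodic_dynamical_system = dynamical_system +
  assumes ergodic:
    "\<And>A. A \<in> sets M \<Longrightarrow> T -` A \<inter> space M = A \<Longrightarrow> measure M A = 0 \<or> measure M A = 1"

definition atom_of :: "'a measure \<Rightarrow> 'a set \<Rightarrow> bool" where
  "atom_of M A \<longleftrightarrow> A \<in> sets M \<and> emeasure M A > 0 \<and>
     (\<forall>B\<in>sets M. B \<subseteq> A \<longrightarrow> emeasure M B = 0 \<or> emeasure M (A - B) = 0)"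

definition nonatomic :: "'a measure \<Rightarrow> bool" where
  "nonatomic M \<longleftrightarrow> (\<nexists>A. atom_of M A)"

(* Intended for p > 0, including p < 1.  Elements are functions rather than
   classes modulo null sets. *)
definition Lp :: "real \<Rightarrow> 'a measure \<Rightarrow> ('a \<Rightarrow> real) set" where
  "Lp p M = {f \<in> borel_measurable M. integrable M (\<lambda>x. \<bar>f x\<bar> powr p)}"

definition p0 :: real where
  "p0 = 1 + log 6 2 / (1 + log 6 2)"

end

theory Submission
  imports Defs
begin

text \<open>
  Averages over arithmetic progressions can be made large at every point by very sparse sets.
  If an integer \<open>x\<close> is written as \<open>x = 3 a - c\<close>, the choice \<open>n = c - a\<close> gives
  \<open>x + n = 2 a\<close>, \<open>x + 2 n = a + c\<close> and \<open>x + 3 n = 2 c\<close>. As \<open>a\<close> runs through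
  \<open>{0,\<dots>,3}\<close> and \<open>c\<close> through \<open>{0,1,2}\<close>, the number \<open>3 a - c\<close> runs through \<open>{-2,\<dots>,9}\<close>, a
  complete residue system modulo \<open>12\<close>, while \<open>a\<close>, \<open>a + c\<close> and \<open>c\<close> take only \<open>4\<close>, \<open>6\<close> and \<open>3\<close>
  values. Using this in each of \<open>m\<close> digits to base \<open>12\<close> produces, for \<open>Q = 12^m\<close>, three sets of
  residues modulo \<open>Q\<close> with at most \<open>4^m\<close>, \<open>6^m\<close> and \<open>3^m\<close> elements such that every \<open>x\<close> has an
  \<open>n \<le> Q\<close> for which \<open>x + n\<close>, \<open>x + 2 n\<close>, \<open>x + 3 n\<close> lie in them, respectively
  (\<open>progression_hits_digit_sums\<close>).

  The pattern is carried to the dynamical system by a clock: an integer-valued function that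
  increases by \<open>1\<close> along orbits for \<open>3 Q\<close> steps, except when started in a set of measure at
  most \<open>1 / Q\<close>. Minus the hitting time of a very small set is such a function (\<open>clock_exists\<close>),
  and the invariance of the measure forces each residue of the clock modulo \<open>Q\<close> to have measure
  at most \<open>2 / Q\<close> (\<open>clock_residue_measure\<close>). The three residue sets therefore pull back to sets
  of measure at most \<open>2 / 3^m\<close>, \<open>2 / 2^m\<close> and \<open>2 / 4^m\<close>. On these sets the functions \<open>F\<close>, \<open>G\<close>, \<open>H\<close> are made
  at least as large as \<open>(3 t)^(m/p)\<close>, \<open>(2 t)^(m/p)\<close> and \<open>(4 t)^(m/p)\<close>. For \<open>t < 1\<close> the \<open>p\<close>-th powers of
  these bumps have integrals \<open>O(t^m)\<close>, which can be summed over \<open>m\<close> (\<open>Lp_majorant\<close>). A single term of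
  the average of length \<open>Q\<close> is then at least \<open>(24 t^3)^(m/p)\<close>, so the average is at least
  \<open>((24 t^3)^(1/p) / 12)^m\<close>. This tends to infinity as soon as \<open>24 t^3 > 12^p\<close>, and a suitable
  \<open>t < 1\<close> exists precisely when \<open>p < ln 24 / ln 12 = p0\<close>. By Borel-Cantelli almost every point
  is exceptional for only finitely many \<open>m\<close>.
\<close>

section \<open>A sparse pattern modulo powers of 12\<close>

text \<open>
  The digits are bounded by a parameter independent of the base \<open>12\<close>, so that these sets become
  sparse in the integers modulo \<open>12^m\<close>. They are sets of integers rather than of residues: then
  no carries occur when two of them are added.
\<close>
fun digit_sums :: "nat \<Rightarrow> nat \<Rightarrow> int set" where
  "digit_sums d 0 = {0}"
| "digit_sums d (Suc m) = (\<lambda>(u, v). u + 12 * v) ` ({0..<int d} \<times> digit_sums d m)"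

lemma finite_digit_sums: "finite (digit_sums d m)"
  by (induction m) auto

lemma card_digit_sums: "card (digit_sums d m) \<le> d ^ m"
proof (induction m)
  case (Suc m)
  have "card (digit_sums d (Suc m)) \<le> card ({0..<int d} \<times> digit_sums d m)"
    unfolding digit_sums.simps by (rule card_image_le) (simp add: finite_digit_sums)
  also have "\<dots> \<le> d * d ^ m"
    using Suc by (simp add: card_cartesian_product)
  finally show ?case by simp
qed simp

lemma digit_sums_SucI:
  "0 \<le> u \<Longrightarrow> u < int d \<Longrightarrow> v \<in> digit_sums d m \<Longrightarrow> u + 12 * v \<in> digit_sums d (Suc m)"
  by force

text \<open>
  A digit of \<open>x\<close> can be peeled off because \<open>3 a - c\<close> determines \<open>c\<close> modulo \<open>3\<close> and then \<open>a\<close>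
  modulo \<open>4\<close>, and every residue modulo \<open>12\<close> arises. The three digit conditions involve no carries,
  as the digits of \<open>a + c\<close> are the sums of the digits of \<open>a\<close> and \<open>c\<close>.
\<close>
lemma residue_digits:
  fixes x :: int
  shows "\<exists>a\<in>digit_sums 4 m. \<exists>c\<in>digit_sums 3 m. a + c \<in> digit_sums 6 m \<and>
           12 ^ m dvd x - (3 * a - c)"
proof (induction m arbitrary: x)
  case (Suc m)
  define c0 where "c0 = (- x) mod 3"
  define a0 where "a0 = ((x + c0) div 3) mod 4"
  define y where "y = (x + c0) div 3 div 4"
  have "x + c0 = 3 * ((x + c0) div 3)"
    unfolding c0_def by presburger
  also have "(x + c0) div 3 = 4 * y + a0"
    by (simp add: y_def a0_def)
  finally have x: "x = 3 * a0 - c0 + 12 * y" by simp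
  have bds: "0 \<le> c0" "c0 < 3" "0 \<le> a0" "a0 < 4"
    unfolding a0_def c0_def by simp_all
  obtain a c where ac: "a \<in> digit_sums 4 m" "c \<in> digit_sums 3 m" "a + c \<in> digit_sums 6 m"
    and dv: "12 ^ m dvd y - (3 * a - c)"
    using Suc.IH[of y] by blast
  have A: "a0 + 12 * a \<in> digit_sums 4 (Suc m)" and C: "c0 + 12 * c \<in> digit_sums 3 (Suc m)"
    using bds ac by (auto intro!: digit_sums_SucI simp del: digit_sums.simps)
  have "(a0 + c0) + 12 * (a + c) \<in> digit_sums 6 (Suc m)"
    using bds ac by (intro digit_sums_SucI) auto
  moreover have "(a0 + c0) + 12 * (a + c) = (a0 + 12 * a) + (c0 + 12 * c)" by simp
  ultimately have B: "(a0 + 12 * a) + (c0 + 12 * c) \<in> digit_sums 6 (Suc m)" by metis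
  have "x - (3 * (a0 + 12 * a) - (c0 + 12 * c)) = 12 * (y - (3 * a - c))"
    using x by (simp add: algebra_simps)
  then have "12 ^ Suc m dvd x - (3 * (a0 + 12 * a) - (c0 + 12 * c))"
    using dv by (simp del: right_diff_distrib_numeral)
  then show ?case using A B C by blast
qed simp

definition residues_of :: "nat \<Rightarrow> int set \<Rightarrow> int set" where
  "residues_of m S = (\<lambda>a. a mod 12 ^ m) ` S"

lemma card_residues_of: "finite S \<Longrightarrow> card (residues_of m S) \<le> card S"
  unfolding residues_of_def by (rule card_image_le)

text \<open>
  The number \<open>n\<close> is the representative of \<open>c - a\<close> in \<open>{1,\<dots>,12^m}\<close>, where
  \<open>x\<close> is congruent to \<open>3 a - c\<close>.
\<close>
lemma progression_hits_digit_sums: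
  fixes x :: int
  shows "\<exists>n\<in>{1..12 ^ m}.
     (x + int n) mod 12 ^ m \<in> residues_of m ((*) 2 ` digit_sums 4 m) \<and>
     (x + int (2 * n)) mod 12 ^ m \<in> residues_of m (digit_sums 6 m) \<and>
     (x + int (3 * n)) mod 12 ^ m \<in> residues_of m ((*) 2 ` digit_sums 3 m)"
proof -
  define Q :: int where "Q = 12 ^ m"
  have Q: "Q > 0" by (simp add: Q_def)
  obtain a c where ac: "a \<in> digit_sums 4 m" "c \<in> digit_sums 3 m" "a + c \<in> digit_sums 6 m"
    and dv: "Q dvd x - (3 * a - c)"
    using residue_digits[of m x] unfolding Q_def by blast
  define k where "k = (c - a - 1) mod Q + 1"
  have k: "1 \<le> k" "k \<le> Q" using Q by (auto simp: k_def add1_zle_eq)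
  have kd: "Q dvd k - (c - a)"
  proof -
    have "Q dvd (c - a - 1) mod Q - (c - a - 1)"
      by (metis mod_eq_dvd_iff mod_mod_trivial)
    then show ?thesis by (simp add: k_def algebra_simps)
  qed
  have 1: "(x + k) mod Q = (2 * a) mod Q"
  proof -
    have "x + k - 2 * a = (x - (3 * a - c)) + (k - (c - a))" by simp
    then show ?thesis using dv kd by (metis dvd_add mod_eq_dvd_iff)
  qed
  have 2: "(x + 2 * k) mod Q = (a + c) mod Q"
  proof -
    have "x + 2 * k - (a + c) = (x - (3 * a - c)) + 2 * (k - (c - a))" by simp
    then show ?thesis using dv kd by (metis dvd_add dvd_mult mod_eq_dvd_iff)
  qed
  have 3: "(x + 3 * k) mod Q = (2 * c) mod Q"
  proof -
    have "x + 3 * k - 2 * c = (x - (3 * a - c)) + 3 * (k - (c - a))" by simp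
    then show ?thesis using dv kd by (metis dvd_add dvd_mult mod_eq_dvd_iff)
  qed
  have kn: "int (nat k) = k" using k by simp
  have "nat k \<in> {1..12 ^ m}"
  proof -
    have "nat k \<le> nat Q" using k by simp
    also have "nat Q = 12 ^ m" by (simp add: Q_def nat_power_eq)
    finally show ?thesis using k by simp
  qed
  moreover have "(x + int (nat k)) mod 12 ^ m \<in> residues_of m ((*) 2 ` digit_sums 4 m)"
    using 1 ac(1) unfolding residues_of_def kn Q_def by blast
  moreover have "(x + int (2 * nat k)) mod 12 ^ m \<in> residues_of m (digit_sums 6 m)"
    using 2 ac(3) kn unfolding residues_of_def Q_def by force
  moreover have "(x + int (3 * nat k)) mod 12 ^ m \<in> residues_of m ((*) 2 ` digit_sums 3 m)"
    using 3 ac(2) kn unfolding residues_of_def Q_def by force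
  ultimately show ?thesis by blast
qed

section \<open>Clocks on ergodic systems\<close>

lemma (in prob_space) nonatomic_half:
  assumes "nonatomic M" "A \<in> sets M" "measure M A > 0"
  shows "\<exists>B\<in>sets M. 0 < measure M B \<and> measure M B \<le> measure M A / 2"
proof -
  have "\<not> atom_of M A" using assms(1) by (simp add: nonatomic_def)
  then obtain B where B: "B \<in> sets M" "B \<subseteq> A" "emeasure M B \<noteq> 0" "emeasure M (A - B) \<noteq> 0"
    using assms(2,3) by (auto simp: atom_of_def emeasure_eq_measure)
  have pos: "0 < measure M B" "0 < measure M (A - B)"
    using B by (auto simp: emeasure_eq_measure zero_less_measure_iff)
  have diff: "measure M (A - B) = measure M A - measure M B"
    using B assms(2) by (intro finite_measure_Diff) auto
  show ?thesis
  proof (cases "measure M B \<le> measure M A / 2")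
    case False
    then show ?thesis
      using pos diff B(1) assms(2)
      by (intro bexI[of _ "A - B"]) auto
  qed (use B(1) pos in blast)
qed

lemma (in prob_space) nonatomic_small_set:
  assumes "nonatomic M" "e > 0"
  shows "\<exists>E\<in>sets M. 0 < measure M E \<and> measure M E < e"
proof -
  have "\<exists>E\<in>sets M. 0 < measure M E \<and> measure M E \<le> (1/2) ^ k" for k :: nat
  proof (induction k)
    case 0
    show ?case by (rule bexI[of _ "space M"]) (auto simp: prob_space)
  next
    case (Suc k)
    then obtain A where A: "A \<in> sets M" "0 < measure M A" "measure M A \<le> (1/2) ^ k" by blast
    from nonatomic_half[OF assms(1) A(1,2)] show ?case using A(3) by force
  qed
  moreover obtain k :: nat where "(1/2) ^ k < e"
    using real_arch_pow_inv[of e "1/2"] assms(2) by auto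
  ultimately show ?thesis by (meson le_less_trans)
qed

context dynamical_system
begin

lemma iterate_measurable [measurable]: "T ^^ n \<in> measurable M M"
proof (induction n)
  case 0
  then show ?case by (simp add: id_def)
next
  case (Suc n)
  then show ?case using T_measurable by (auto intro: measurable_comp)
qed

lemma distr_iterate: "distr M M (T ^^ n) = M"
proof (induction n)
  case 0
  then show ?case by (simp add: id_def distr_id)
next
  case (Suc n)
  have "distr M M (T ^^ Suc n) = distr (distr M M (T ^^ n)) M T"
    using T_measurable by (simp add: distr_distr)
  then show ?case unfolding Suc preserving .
qed

lemma measure_vimage_iterate:
  "A \<in> sets M \<Longrightarrow> measure M ((T ^^ n) -` A \<inter> space M) = measure M A"
  using measure_distr[OF iterate_measurable, of A n] distr_iterate[of n] by simp

lemma iterate_in_space: "x \<in> space M \<Longrightarrow> (T ^^ n) x \<in> space M"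
  by (rule measurable_space[OF iterate_measurable])

lemma AE_along_orbit:
  assumes "AE x in M. P x"
  shows "AE x in M. \<forall>n. P ((T ^^ n) x)"
proof -
  have "AE x in M. P ((T ^^ n) x)" for n
    using assms by (intro AE_distrD[OF iterate_measurable]) (subst distr_iterate)
  then show ?thesis by (simp add: AE_all_countable)
qed

end

text \<open>
  Ergodicity is assumed for strictly invariant sets only, so it is applied to the set \<open>U\<close> of points
  that visit \<open>E\<close> infinitely often, which is strictly invariant. It has positive measure because
  it is the decreasing limit of the sets \<open>D n\<close> of points that visit \<open>E\<close> at time \<open>n\<close> or later, and
  these all have the measure of \<open>D 0 \<supseteq> E\<close>.
\<close>
lemma (in ergodic_dynamical_system) AE_visits:
  assumes E: "E \<in> sets M" "measure M E > 0"
  shows "AE x in M. \<exists>k. (T ^^ k) x \<in> E"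
proof -
  define D where "D n = {x \<in> space M. \<exists>k\<ge>n. (T ^^ k) x \<in> E}" for n
  have D_sets [measurable]: "D n \<in> sets M" for n
    unfolding D_def using E(1) by measurable
  have D_shift: "D n = (T ^^ n) -` D 0 \<inter> space M" for n
  proof -
    have "(\<exists>k\<ge>n. (T ^^ k) x \<in> E) \<longleftrightarrow> (\<exists>k. (T ^^ k) ((T ^^ n) x) \<in> E)" for x
      by (metis add.commute comp_apply funpow_add le_add1 le_add_diff_inverse)
    then show ?thesis by (auto simp: D_def iterate_in_space)
  qed
  define U where "U = (\<Inter>n. D n)"
  have U [measurable]: "U \<in> sets M" unfolding U_def by measurable
  have inv: "T -` U \<inter> space M = U"
  proof -
    have D_Suc: "x \<in> D (Suc n) \<longleftrightarrow> T x \<in> D n" if "x \<in> space M" for x n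
    proof -
      have "T x \<in> space M" using iterate_in_space[OF that, of 1] by simp
      moreover have "(\<exists>k\<ge>Suc n. (T ^^ k) x \<in> E) \<longleftrightarrow> (\<exists>k\<ge>n. (T ^^ k) (T x) \<in> E)"
      proof
        assume "\<exists>k\<ge>Suc n. (T ^^ k) x \<in> E"
        then obtain k where "Suc n \<le> k" "(T ^^ k) x \<in> E" by blast
        then show "\<exists>k\<ge>n. (T ^^ k) (T x) \<in> E"
          by (intro exI[of _ "k - 1"]) (cases k, auto simp: funpow_swap1)
      next
        assume "\<exists>k\<ge>n. (T ^^ k) (T x) \<in> E"
        then obtain k where "n \<le> k" "(T ^^ k) (T x) \<in> E" by blast
        then show "\<exists>k\<ge>Suc n. (T ^^ k) x \<in> E"
          by (intro exI[of _ "Suc k"]) (auto simp: funpow_swap1)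
      qed
      ultimately show ?thesis using that by (simp add: D_def)
    qed
    have D0: "D (Suc n) \<subseteq> D n" for n unfolding D_def using Suc_leD by blast
    have "x \<in> U \<longleftrightarrow> T x \<in> U" if "x \<in> space M" for x
    proof -
      have "x \<in> U \<longleftrightarrow> (\<forall>n. x \<in> D (Suc n))" unfolding U_def using D0 by blast
      then show ?thesis using D_Suc[OF that] by (simp add: U_def)
    qed
    moreover have "U \<subseteq> space M" unfolding U_def D_def by blast
    ultimately show ?thesis by blast
  qed
  have "(\<lambda>n. measure M (D n)) \<longlonglongrightarrow> measure M U"
    unfolding U_def
  proof (rule finite_Lim_measure_decseq)
    show "decseq D" unfolding decseq_def D_def using le_trans by blast
  qed (use D_sets in blast)
  moreover have "measure M (D n) = measure M (D 0)" for n
    unfolding D_shift[of n] by (rule measure_vimage_iterate[OF D_sets])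
  then have "(\<lambda>n. measure M (D n)) \<longlonglongrightarrow> measure M (D 0)"
    by (intro tendsto_eventually always_eventually allI)
  ultimately have "measure M U = measure M (D 0)"
    by (rule LIMSEQ_unique)
  moreover have "measure M E \<le> measure M (D 0)"
  proof (rule finite_measure_mono)
    show "E \<subseteq> D 0"
    proof
      fix x assume "x \<in> E"
      then show "x \<in> D 0"
        using sets.sets_into_space[OF E(1)] by (auto simp: D_def intro!: exI[of _ 0])
    qed
  qed simp
  ultimately have "measure M U = 1"
    using ergodic[OF U inv] E(2) by linarith
  then have "AE x in M. x \<in> U" using AE_prob_1 by simp
  then show ?thesis by eventually_elim (auto simp: U_def D_def)
qed

text \<open>
  This takes the place of a Rokhlin tower. The time until the next visit to a set \<open>E\<close> decreases
  by \<open>1\<close> with each step, as long as \<open>E\<close> is not reached; so its negative is a clock, and the points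
  that fail within \<open>K\<close> steps meet \<open>E\<close> within that time, which has measure at most \<open>K\<close> times that
  of \<open>E\<close>.
\<close>
lemma (in ergodic_dynamical_system) clock_exists:
  assumes "nonatomic M" "e > 0"
  shows "\<exists>(l :: 'a \<Rightarrow> int) B. l \<in> measurable M (count_space UNIV) \<and> B \<in> sets M \<and> measure M B \<le> e \<and>
    (\<forall>x\<in>space M - B. \<forall>j\<le>K. l ((T ^^ j) x) = l x + int j)"
proof -
  obtain E where E [measurable]: "E \<in> sets M" and E_pos: "0 < measure M E"
    and E_small: "measure M E < e / real (Suc K)"
    using nonatomic_small_set[OF assms(1), of "e / real (Suc K)"] assms(2) by auto
  define h where "h x = (LEAST k. (T ^^ k) x \<in> E)" for x
  define V where "V = {x \<in> space M. \<not> (\<exists>k. (T ^^ k) x \<in> E)}"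
  define B where "B = V \<union> (\<Union>j<K. (T ^^ j) -` E \<inter> space M)"
  have h [measurable]: "h \<in> measurable M (count_space UNIV)" unfolding h_def by measurable
  have V [measurable]: "V \<in> sets M" unfolding V_def by measurable
  have "B \<in> sets M" unfolding B_def by measurable
  moreover have "measure M B \<le> e"
  proof -
    have "AE x in M. x \<notin> V" using AE_visits[OF E E_pos] by eventually_elim (auto simp: V_def)
    then have "measure M V = 0" using prob_eq_0 V by blast
    moreover have "measure M B \<le> measure M V + measure M (\<Union>j<K. (T ^^ j) -` E \<inter> space M)"
      unfolding B_def by (rule measure_Un_le) measurable
    moreover have "measure M (\<Union>j<K. (T ^^ j) -` E \<inter> space M)
        \<le> (\<Sum>j<K. measure M ((T ^^ j) -` E \<inter> space M))"
      by (rule finite_measure_subadditive_finite) auto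
    moreover have "(\<Sum>j<K. measure M ((T ^^ j) -` E \<inter> space M)) = real K * measure M E"
      by (simp add: measure_vimage_iterate)
    moreover have "real K * measure M E \<le> e"
    proof -
      have "real K * measure M E \<le> real (Suc K) * measure M E"
        using E_pos by (intro mult_right_mono) auto
      also have "\<dots> \<le> e" using E_small by (simp add: field_simps)
      finally show ?thesis .
    qed
    ultimately show ?thesis by linarith
  qed
  moreover have "- int (h ((T ^^ j) x)) = - int (h x) + int j"
    if x: "x \<in> space M - B" and j: "j \<le> K" for x j
  proof -
    obtain k where k: "(T ^^ k) x \<in> E" using x unfolding B_def V_def by blast
    have notE: "(T ^^ i) x \<notin> E" if "i < j" for i
      using that x j by (auto simp: B_def)
    have hx: "(T ^^ h x) x \<in> E" unfolding h_def using k by (rule LeastI)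
    then have "j \<le> h x" using notE by (meson not_le)
    have shift: "(T ^^ i) ((T ^^ j) x) = (T ^^ (i + j)) x" for i by (simp add: funpow_add)
    have "h ((T ^^ j) x) = h x - j"
      unfolding h_def[of "(T ^^ j) x"] shift
    proof (rule Least_equality)
      show "(T ^^ (h x - j + j)) x \<in> E" using hx \<open>j \<le> h x\<close> by simp
    next
      fix i assume "(T ^^ (i + j)) x \<in> E"
      then have "h x \<le> i + j" unfolding h_def by (rule Least_le)
      then show "h x - j \<le> i" by simp
    qed
    then show ?thesis using \<open>j \<le> h x\<close> by simp
  qed
  moreover have "(\<lambda>x. - int (h x)) \<in> measurable M (count_space UNIV)" by measurable
  ultimately show ?thesis by (intro exI[of _ "\<lambda>x. - int (h x)"] exI[of _ B]) blast
qed

text \<open>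
  Away from \<open>B\<close>, the \<open>j\<close>-th iterate of \<open>T\<close> carries the level set of the residue \<open>s\<close> into that of
  \<open>s + j\<close>. Hence the part of the former outside \<open>B\<close> has at most the measure of each of \<open>Q\<close>
  disjoint sets, and so at most \<open>1 / Q\<close>.
\<close>
lemma (in dynamical_system) clock_residue_measure:
  fixes l :: "'a \<Rightarrow> int" and Q :: nat
  assumes l [measurable]: "l \<in> measurable M (count_space UNIV)"
    and B [measurable]: "B \<in> sets M" and B_small: "measure M B \<le> 1 / real Q"
    and clock: "\<And>x j. x \<in> space M - B \<Longrightarrow> j < Q \<Longrightarrow> l ((T ^^ j) x) = l x + int j"
    and "Q > 0"
  shows "measure M {x \<in> space M. l x mod int Q = s} \<le> 2 / real Q"
proof -
  define W where "W r = {x \<in> space M. l x mod int Q = r}" for r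
  have W [measurable]: "W r \<in> sets M" for r unfolding W_def by measurable
  have shift: "measure M (W s - B) \<le> measure M (W ((s + int j) mod int Q))" if "j < Q" for j
  proof -
    have "W s - B \<subseteq> (T ^^ j) -` W ((s + int j) mod int Q) \<inter> space M"
      using that by (auto simp: W_def clock iterate_in_space mod_add_left_eq)
    then have "measure M (W s - B) \<le> measure M ((T ^^ j) -` W ((s + int j) mod int Q) \<inter> space M)"
      by (intro finite_measure_mono) measurable
    then show ?thesis by (simp add: measure_vimage_iterate)
  qed
  have "real Q * measure M (W s - B) = (\<Sum>j<Q. measure M (W s - B))" by simp
  also have "\<dots> \<le> (\<Sum>j<Q. measure M (W ((s + int j) mod int Q)))"
    by (rule sum_mono) (use shift in auto)
  also have "\<dots> = measure M (\<Union>j<Q. W ((s + int j) mod int Q))"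
  proof (rule finite_measure_finite_Union[symmetric])
    show "disjoint_family_on (\<lambda>j. W ((s + int j) mod int Q)) {..<Q}"
    proof (unfold disjoint_family_on_def, intro ballI impI)
      fix i j assume ij: "i \<in> {..<Q}" "j \<in> {..<Q}" "i \<noteq> j"
      have "(s + int i) mod int Q \<noteq> (s + int j) mod int Q"
      proof
        assume "(s + int i) mod int Q = (s + int j) mod int Q"
        then have "int Q dvd int i - int j" by (simp add: mod_eq_dvd_iff)
        moreover have "\<bar>int i - int j\<bar> < int Q" using ij by auto
        ultimately show False using ij(3) dvd_imp_le_int[of "int i - int j" "int Q"] by auto
      qed
      then show "W ((s + int i) mod int Q) \<inter> W ((s + int j) mod int Q) = {}"
        by (auto simp: W_def)
    qed
  qed auto
  also have "\<dots> \<le> 1" by (rule prob_le_1)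
  finally have "measure M (W s - B) \<le> 1 / real Q"
    using \<open>Q > 0\<close> by (simp add: field_simps)
  moreover have "measure M (W s) \<le> measure M (W s - B) + measure M B"
  proof -
    have "measure M (W s) \<le> measure M ((W s - B) \<union> B)" by (intro finite_measure_mono) auto
    also have "\<dots> \<le> measure M (W s - B) + measure M B"
      by (rule measure_Un_le) auto
    finally show ?thesis .
  qed
  ultimately show ?thesis using B_small by (simp add: W_def)
qed

section \<open>Functions with prescribed large values\<close>

lemma (in prob_space) measure_finite_preimage_le:
  assumes "\<And>s. s \<in> S \<Longrightarrow> measure M {x \<in> space M. g x = s} \<le> c" "finite S"
    and [measurable]: "g \<in> measurable M (count_space UNIV)"
  shows "measure M {x \<in> space M. g x \<in> S} \<le> real (card S) * c"
proof -
  have "{x \<in> space M. g x \<in> S} = (\<Union>s\<in>S. {x \<in> space M. g x = s})" by auto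
  then have "measure M {x \<in> space M. g x \<in> S} \<le> (\<Sum>s\<in>S. measure M {x \<in> space M. g x = s})"
    using assms(2) by (auto intro!: finite_measure_subadditive_finite)
  also have "\<dots> \<le> real (card S) * c" using assms(1) by (intro sum_bounded_above)
  finally show ?thesis .
qed

text \<open>
  The witness is the \<open>p\<close>-th root of the sum of the \<open>p\<close>-th powers of the bumps \<open>c m\<close> on \<open>S m\<close>.
  It dominates each bump, and the integral of its \<open>p\<close>-th power is the given series, also for
  \<open>p < 1\<close>, where no triangle inequality is available.
\<close>
lemma (in prob_space) Lp_majorant:
  fixes c :: "nat \<Rightarrow> real" and S :: "nat \<Rightarrow> 'a set"
  assumes "p > 0" and S [measurable]: "\<And>m. S m \<in> sets M" and c: "\<And>m. c m \<ge> 0"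
    and sm: "summable (\<lambda>m. c m powr p * measure M (S m))"
  shows "\<exists>F\<in>Lp p M. (\<forall>x. F x \<ge> 0) \<and> (AE x in M. \<forall>m. x \<in> S m \<longrightarrow> c m \<le> F x)"
proof -
  define f where "f m x = c m powr p * indicator (S m) x" for m and x :: 'a
  have f [measurable]: "f m \<in> borel_measurable M" for m unfolding f_def by measurable
  have f0: "f m x \<ge> 0" for m x by (simp add: f_def)
  have int: "integrable M (f m)" for m
    unfolding f_def by (intro integrable_mult_right) (simp add: emeasure_eq_measure)
  have intf: "(\<integral>x. norm (f m x) \<partial>M) = c m powr p * measure M (S m)" for m
    by (simp add: f_def abs_mult)
  have "(\<integral>\<^sup>+x. (\<Sum>m. ennreal (f m x)) \<partial>M) = (\<Sum>m. \<integral>\<^sup>+x. ennreal (f m x) \<partial>M)"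
    by (rule nn_integral_suminf) simp
  also have "\<dots> = (\<Sum>m. ennreal (c m powr p * measure M (S m)))"
    using intf f0 by (simp add: nn_integral_eq_integral[OF int])
  also have "\<dots> \<noteq> \<infinity>"
    using sm by (subst suminf_ennreal2) auto
  finally have "AE x in M. (\<Sum>m. ennreal (f m x)) \<noteq> \<infinity>"
    by (intro nn_integral_PInf_AE) auto
  then have AE_sum: "AE x in M. summable (\<lambda>m. f m x)"
    by eventually_elim (use f0 in \<open>auto intro: summable_suminf_not_top\<close>)
  have int_sum: "integrable M (\<lambda>x. \<Sum>m. f m x)"
    by (rule integrable_suminf[OF int]) (use AE_sum sm f0 intf in auto)
  \<comment> \<open>The absolute value matters only on the null set where the series diverges: there the value
    of the sum is arbitrary, but \<open>\<bar>F x\<bar> powr p\<close> still has to be its absolute value.\<close>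
  define F where "F x = \<bar>\<Sum>m. f m x\<bar> powr (1 / p)" for x
  have [measurable]: "F \<in> borel_measurable M" unfolding F_def by measurable
  have "\<bar>F x\<bar> powr p = \<bar>\<Sum>m. f m x\<bar>" for x
    using \<open>p > 0\<close> by (simp add: F_def powr_powr)
  then have "F \<in> Lp p M" using int_sum by (simp add: Lp_def)
  moreover have "AE x in M. \<forall>m. x \<in> S m \<longrightarrow> c m \<le> F x"
    using AE_sum
  proof eventually_elim
    case (elim x)
    show ?case
    proof (intro allI impI)
      fix m assume "x \<in> S m"
      then have "c m powr p = f m x" by (simp add: f_def)
      also have "\<dots> = sum (\<lambda>m. f m x) {m}" by simp
      also have "\<dots> \<le> (\<Sum>m. f m x)" by (rule sum_le_suminf[OF elim]) (auto simp: f0)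
      finally have "(c m powr p) powr (1 / p) \<le> (\<Sum>m. f m x) powr (1 / p)"
        using \<open>p > 0\<close> by (intro powr_mono2) auto
      moreover have "(c m powr p) powr (1 / p) = c m" using c[of m] \<open>p > 0\<close> by (simp add: powr_powr)
      moreover have "(\<Sum>m. f m x) \<ge> 0" by (rule suminf_nonneg[OF elim]) (rule f0)
      ultimately show "c m \<le> F x" by (simp add: F_def)
    qed
  qed
  ultimately show ?thesis by (intro bexI[of _ F]) (auto simp: F_def)
qed

text \<open>
  Since \<open>p0 = ln 24 / ln 12\<close>, the quotient \<open>12^p / 24\<close> is less than \<open>1\<close>; its fourth root leaves
  room for both demands on \<open>t\<close>: the bumps decay like \<open>t^m\<close>, and \<open>24 t^3 = 12^p / t\<close>
  still exceeds \<open>12^p\<close>.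
\<close>
lemma height_ratio:
  fixes p :: real
  assumes "0 < p" "p < p0"
  shows "\<exists>t. 0 < t \<and> t < 1 \<and> 24 * t ^ 4 = 12 powr p"
proof -
  have "p0 = ln 24 / ln (12::real)"
  proof -
    have "ln (24::real) = ln 12 + ln 2" "ln (12::real) = ln 6 + ln 2"
      by (simp_all flip: ln_mult_pos)
    moreover have "ln (6::real) > 0" "ln (2::real) > 0" by simp_all
    moreover from this have "ln (2::real) + ln 6 \<noteq> 0" by linarith
    ultimately show ?thesis unfolding p0_def log_def by (simp add: field_simps)
  qed
  then have "p < ln 24 / ln 12" using assms(2) by simp
  then have "p * ln 12 < ln (24::real)" by (subst (asm) pos_less_divide_eq) simp_all
  then have lt: "12 powr p < (24::real)"
    by (simp add: powr_def) (metis exp_less_cancel_iff exp_ln zero_less_numeral)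
  define t where "t = root 4 (12 powr p / 24)"
  have "t ^ 4 = 12 powr p / 24" unfolding t_def by (rule real_root_pow_pos2) auto
  moreover have "0 < t" "t < 1" using lt unfolding t_def by auto
  ultimately show ?thesis by (intro exI[of _ t]) auto
qed

lemma limsup_infinity_if_subseq:
  fixes a b :: "nat \<Rightarrow> real"
  assumes "eventually (\<lambda>m. b m \<le> a (r m)) sequentially" "filterlim b at_top sequentially"
    "strict_mono r"
  shows "limsup (\<lambda>N. ereal (a N)) = \<infinity>"
proof -
  have "filterlim (\<lambda>m. a (r m)) at_top sequentially"
    using filterlim_at_top_mono[OF assms(2,1)] .
  then have "(\<lambda>m. ereal (a (r m))) \<longlonglongrightarrow> \<infinity>"
    unfolding tendsto_PInfty_eq_at_top .
  then have "limsup ((\<lambda>N. ereal (a N)) \<circ> r) = \<infinity>"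
    by (intro lim_imp_Limsup) (auto simp: comp_def)
  moreover have "limsup ((\<lambda>N. ereal (a N)) \<circ> r) \<le> limsup (\<lambda>N. ereal (a N))"
    using limsup_subseq_mono[OF assms(3)] .
  ultimately show ?thesis by simp
qed

section \<open>Divergence of the trilinear averages\<close>

theorem theorem2p1:
  fixes p :: real and M :: "'a measure" and T :: "'a \<Rightarrow> 'a"
  assumes "0 < p" and "p < p0"
    and "ergodic_dynamical_system M T"
    and "nonatomic M"
  shows "\<exists>F\<in>Lp p M. \<exists>G\<in>Lp p M. \<exists>H\<in>Lp p M.
    AE x in M.
      limsup (\<lambda>N. ereal ((1 / real N) *
        (\<Sum>n=1..N. F ((T ^^ n) x) * G ((T ^^ (2 * n)) x) * H ((T ^^ (3 * n)) x)))) = \<infinity>"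
proof -
  interpret ergodic_dynamical_system M T by (rule assms(3))
  obtain t where t: "0 < t" "t < 1" "24 * t ^ 4 = 12 powr p"
    using height_ratio[OF assms(1,2)] by blast
  have "\<forall>m::nat. \<exists>(l :: 'a \<Rightarrow> int) B. l \<in> measurable M (count_space UNIV) \<and> B \<in> sets M \<and>
      measure M B \<le> 1 / 12 ^ m \<and>
      (\<forall>x\<in>space M - B. \<forall>j\<le>3 * 12 ^ m. l ((T ^^ j) x) = l x + int j)"
    by (intro allI clock_exists assms(4)) simp
  then obtain l :: "nat \<Rightarrow> 'a \<Rightarrow> int" and B where
    l [measurable]: "\<And>m. l m \<in> measurable M (count_space UNIV)" and
    B [measurable]: "\<And>m. B m \<in> sets M" and B_small: "\<And>m. measure M (B m) \<le> 1 / 12 ^ m" and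
    clock: "\<And>m x j. x \<in> space M - B m \<Longrightarrow> j \<le> 3 * 12 ^ m \<Longrightarrow> l m ((T ^^ j) x) = l m x + int j"
    by metis
  define level where "level R m = {x \<in> space M. l m x mod 12 ^ m \<in> R m}" for R :: "nat \<Rightarrow> int set" and m
  \<comment> \<open>The heights are chosen so that \<open>c q m powr p\<close> is \<open>(q t)^m\<close>: a set of \<open>d^m\<close> residues has
    measure at most \<open>2 (d / 12)^m\<close>, and \<open>q d = 12\<close> leaves the summable bound \<open>2 t^m\<close>.\<close>
  define c where "c q m = (q * t) powr (real m / p)" for q :: real and m :: nat
  have level_sets: "level R m \<in> sets M" for R m unfolding level_def by measurable
  have residue: "measure M {x \<in> space M. l m x mod 12 ^ m = s} \<le> 2 / 12 ^ m" for m s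
    using clock_residue_measure[OF l B, of m "12 ^ m" m s] B_small[of m] clock[of _ m] by simp
  have dominating: "\<exists>F\<in>Lp p M. (\<forall>x. F x \<ge> 0) \<and> (AE x in M. \<forall>m. x \<in> level R m \<longrightarrow> c q m \<le> F x)"
    if "q > 0" "\<And>m. finite (R m)" "\<And>m. card (R m) \<le> d ^ m" "q * real d = 12" for R d q
  proof (rule Lp_majorant)
    have bound: "c q m powr p * measure M (level R m) \<le> 2 * t ^ m" for m
    proof -
      have "measure M (level R m) \<le> real (card (R m)) * (2 / 12 ^ m)"
        unfolding level_def by (rule measure_finite_preimage_le) (use residue that in auto)
      also have "\<dots> \<le> real (d ^ m) * (2 / 12 ^ m)"
        using that(3)[of m] by (intro mult_right_mono of_nat_mono) auto
      finally have "c q m powr p * measure M (level R m) \<le> (q * t) ^ m * (real (d ^ m) * (2 / 12 ^ m))"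
        using that(1) t(1) assms(1) by (simp add: c_def powr_powr powr_realpow mult_left_mono
              del: of_nat_power times_divide_eq_right)
      also have "\<dots> = 2 * t ^ m * ((q * real d) ^ m / 12 ^ m)"
        by (simp add: power_mult_distrib)
      finally show ?thesis by (simp add: that(4))
    qed
    show "summable (\<lambda>m. c q m powr p * measure M (level R m))"
    proof (rule summable_comparison_test'[where N = 0])
      show "summable (\<lambda>m. 2 * t ^ m)"
        using t by (intro summable_mult summable_geometric) simp
      show "norm (c q m powr p * measure M (level R m)) \<le> 2 * t ^ m" for m
        using bound[of m] by simp
    qed
  qed (use assms(1) level_sets in \<open>auto simp: c_def\<close>)
  define RF RG RH where "RF m = residues_of m ((*) 2 ` digit_sums 4 m)"
    and "RG m = residues_of m (digit_sums 6 m)"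
    and "RH m = residues_of m ((*) 2 ` digit_sums 3 m)" for m
  have fin: "finite (RF m)" "finite (RG m)" "finite (RH m)" for m
    by (auto simp: RF_def RG_def RH_def residues_of_def finite_digit_sums)
  have card: "card (RF m) \<le> 4 ^ m" "card (RG m) \<le> 6 ^ m" "card (RH m) \<le> 3 ^ m" for m
    unfolding RF_def RG_def RH_def
    by (meson card_digit_sums card_image_le card_residues_of finite_digit_sums finite_imageI le_trans)+
  obtain F where F: "F \<in> Lp p M" "\<And>x. F x \<ge> 0"
      and F_ge: "AE x in M. \<forall>m. x \<in> level RF m \<longrightarrow> c 3 m \<le> F x"
    using dominating[of 3 RF 4] fin card by auto
  obtain G where G: "G \<in> Lp p M" "\<And>x. G x \<ge> 0"
      and G_ge: "AE x in M. \<forall>m. x \<in> level RG m \<longrightarrow> c 2 m \<le> G x"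
    using dominating[of 2 RG 6] fin card by auto
  obtain H where H: "H \<in> Lp p M" "\<And>x. H x \<ge> 0"
      and H_ge: "AE x in M. \<forall>m. x \<in> level RH m \<longrightarrow> c 4 m \<le> H x"
    using dominating[of 4 RH 3] fin card by auto
  have c_prod: "1 / 12 ^ m * (c 3 m * c 2 m * c 4 m) = ((1 / t) powr (1 / p)) ^ m" for m
  proof -
    have "c 3 m * c 2 m * c 4 m = (24 * t ^ 3) powr (real m / p)"
      using t(1) by (simp add: c_def power3_eq_cube mult.assoc flip: powr_mult)
    also have "24 * t ^ 3 = 12 powr p * (1 / t)"
      using t by (simp add: field_simps power4_eq_xxxx power3_eq_cube)
    also have "\<dots> powr (real m / p) = 12 ^ m * (1 / t) powr (real m / p)"
      using t(1) assms(1) by (simp add: powr_divide powr_powr powr_realpow)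
    also have "(1 / t) powr (real m / p) = ((1 / t) powr (1 / p)) ^ m"
      using t(1) by (simp add: powr_powr flip: powr_realpow)
    finally show ?thesis by simp
  qed
  have "1 < (1 / t) powr (1 / p)" using t assms(1) by (intro gr_one_powr) auto
  then have growth: "filterlim (\<lambda>m. ((1 / t) powr (1 / p)) ^ m) at_top sequentially"
    by (intro filterlim_at_infinity_imp_filterlim_at_top filterlim_realpow_sequentially_gt1
          always_eventually allI zero_less_power) (use t(1) in simp_all)
  have "AE x in M. eventually (\<lambda>m. x \<in> space M - B m) sequentially"
  proof (rule borel_cantelli_AE1)
    show "summable (\<lambda>m. measure M (B m))"
    proof (rule summable_comparison_test'[where N = 0])
      show "summable (\<lambda>m. (1 / 12 :: real) ^ m)" by (intro summable_geometric) simp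
      show "norm (measure M (B m)) \<le> (1 / 12) ^ m" for m
        using B_small[of m] by (simp add: power_one_over)
    qed
  qed (auto simp: emeasure_eq_measure)
  then have "AE x in M. limsup (\<lambda>N. ereal ((1 / real N) *
        (\<Sum>n=1..N. F ((T ^^ n) x) * G ((T ^^ (2 * n)) x) * H ((T ^^ (3 * n)) x)))) = \<infinity>"
    using AE_space AE_along_orbit[OF F_ge] AE_along_orbit[OF G_ge] AE_along_orbit[OF H_ge]
  proof eventually_elim
    case (elim x)
    note orbit = elim(3-5)
    show ?case
    proof (rule limsup_infinity_if_subseq[where r = "\<lambda>m. 12 ^ m"])
      show "eventually (\<lambda>m. ((1 / t) powr (1 / p)) ^ m \<le> 1 / real (12 ^ m) *
          (\<Sum>n=1..12 ^ m. F ((T ^^ n) x) * G ((T ^^ (2 * n)) x) * H ((T ^^ (3 * n)) x))) sequentially"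
        using elim(1)
      proof eventually_elim
        case (elim m)
        \<comment> \<open>One term of the average already suffices, the others being nonnegative.\<close>
        obtain n where n: "n \<in> {1..12 ^ m}" "(l m x + int n) mod 12 ^ m \<in> RF m"
          "(l m x + int (2 * n)) mod 12 ^ m \<in> RG m" "(l m x + int (3 * n)) mod 12 ^ m \<in> RH m"
          using progression_hits_digit_sums[of m "l m x"] unfolding RF_def RG_def RH_def by blast
        have l_orbit: "l m ((T ^^ j) x) = l m x + int j" "(T ^^ j) x \<in> space M"
          if "j \<le> 3 * 12 ^ m" for j
          using clock[OF elim that] iterate_in_space elim by blast+
        have "(T ^^ n) x \<in> level RF m" "(T ^^ (2 * n)) x \<in> level RG m"
          "(T ^^ (3 * n)) x \<in> level RH m"
          using l_orbit[of n] l_orbit[of "2 * n"] l_orbit[of "3 * n"] n by (simp_all add: level_def)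
        then have "c 3 m \<le> F ((T ^^ n) x)" "c 2 m \<le> G ((T ^^ (2 * n)) x)"
          "c 4 m \<le> H ((T ^^ (3 * n)) x)"
          using orbit by blast+
        then have "c 3 m * c 2 m * c 4 m \<le> F ((T ^^ n) x) * G ((T ^^ (2 * n)) x) * H ((T ^^ (3 * n)) x)"
          using F(2) G(2) H(2) by (intro mult_mono) (auto simp: c_def)
        also have "\<dots> \<le> (\<Sum>n=1..12 ^ m. F ((T ^^ n) x) * G ((T ^^ (2 * n)) x) * H ((T ^^ (3 * n)) x))"
          using n(1) F(2) G(2) H(2) by (intro member_le_sum) auto
        finally show ?case
          unfolding c_prod[symmetric] by (simp add: divide_right_mono)
      qed
    qed (use growth in \<open>auto simp: strict_mono_def\<close>)
  qed
  then show ?thesis using F(1) G(1) H(1) by blast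
qed

end
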